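(* Let $c>0$ be known and let $(X,U,Y)\in\mathbb{R}^d\times\mathbb{R}^k\times\mathbb{R}^d$ have density $$\eta^{d+k/2}\,f\!\left(\eta\left(\|x-\theta\|^2+\|u\|^2+\|y-c\theta\|^2\right)\right)$$ with unknown $\theta\in\mathbb{R}^d$, $\eta>0$. Consider predictive densities, based on $(X,U)$, for the conditional density of $Y$ given $(X,U)$, under Kullback-Leibler loss. Let $\hat q_0(\cdot;x,u)$ and $\hat q_1(\cdot;x,u)$ be two predictive densities. Then, subject to the finiteness of risks, if $\hat q_1$ dominates $\hat q_0$ in the normal case $f=\phi$, then $\hat q_1$ dominates $\hat q_0$ simultaneously for all scale mixtures of normals $f$.
   Context: $f:[0,\infty)\to[0,\infty)$ is such that $t\mapsto f(\|t\|^2)$ is a probability density on $\mathbb{R}^{2d+k}$. The normal case is $f(t)=\phi(t)=(2\pi)^{-(2d+k)/2}e^{-t/2}$. A scale mixture of normals is $f(t)=\int_{(0,\infty)}z^{-(2d+k)/2}\,\phi(t/z)\,dG(z)$ with $G$ a cumulative distribution function on $(0,\infty)$. A predictive density $\hat q(\cdot;x,u)$ is a density on $\mathbb{R}^d$ for each $(x,u)$; $\hat q_0$ and $\hat q_1$ are fixed functions that do not vary with $f$. With $q_{\theta,\eta}(\cdot|x,u)$ the conditional density of $Y$ given $(X,U)=(x,u)$ under the model with density $f$, the Kullback-Leibler risk is $R_{KL}((\theta,\eta),\hat q)=\mathbb{E}^{X,U,Y}_{\theta,\eta}\log\frac{q_{\theta,\eta}(Y|X,U)}{\hat q(Y;X,U)}$.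 $\hat q_1$ dominates $\hat q_0$ (for a given $f$) if $R_{KL}((\theta,\eta),\hat q_1)\le R_{KL}((\theta,\eta),\hat q_0)$ for all $(\theta,\eta)$, with strict inequality for at least one $(\theta,\eta)$. "Subject to the finiteness of risks" means that the risks of $\hat q_0$ and $\hat q_1$ are assumed finite in the normal case and for the scale mixtures considered. *)

theory Defs
  imports "HOL-Probability.Probability"
begin

definition radial_density :: "'v::euclidean_space itself \<Rightarrow> (real \<Rightarrow> real) \<Rightarrow> bool" where
  "radial_density _ f \<longleftrightarrow>
     (\<forall>t\<ge>0. 0 \<le> f t) \<and>
     (\<lambda>t::'v. f ((norm t)\<^sup>2)) \<in> borel_measurable borel \<and>
     (\<integral>\<^sup>+ t. ennreal (f ((norm (t::'v))\<^sup>2)) \<partial>lborel) = 1"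

text \<open>Generator of the standard normal density in dimension \<open>n\<close>.\<close>

definition normal_gen :: "nat \<Rightarrow> real \<Rightarrow> real" where
  "normal_gen n t = (2 * pi) powr (- real n / 2) * exp (- t / 2)"

text \<open>The mixing law is the distribution \<open>G\<close> whose distribution function is \<open>cdf G\<close>; it is
  carried by \<open>(0,\<infinity>)\<close>. For \<open>t > 0\<close> the integrand is bounded in \<open>z\<close>. At \<open>t = 0\<close> the integral
  may diverge, and then the formula gives \<open>f 0 = 0\<close>; this changes the density of the model on a
  null set only.\<close>

definition scale_mixture_of_normals :: "nat \<Rightarrow> (real \<Rightarrow> real) \<Rightarrow> bool" where
  "scale_mixture_of_normals n f \<longleftrightarrow>
     (\<exists>G. real_distribution G \<and> cdf G 0 = 0 \<and>
       (\<forall>t\<ge>0. f t = (LINT z:{0<..}|G. z powr (- real n / 2) * normal_gen n (t / z))))"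

definition joint_density ::
  "real \<Rightarrow> (real \<Rightarrow> real) \<Rightarrow> real^'d \<Rightarrow> real \<Rightarrow> real^'d \<Rightarrow> real^'k \<Rightarrow> real^'d \<Rightarrow> real" where
  "joint_density c f \<theta> \<eta> x u y =
     \<eta> powr (real CARD('d) + real CARD('k) / 2) *
       f (\<eta> * ((norm (x - \<theta>))\<^sup>2 + (norm u)\<^sup>2 + (norm (y - c *\<^sub>R \<theta>))\<^sup>2))"

definition model ::
  "real \<Rightarrow> (real \<Rightarrow> real) \<Rightarrow> real^'d \<Rightarrow> real \<Rightarrow> ((real^'d) \<times> (real^'k) \<times> (real^'d)) measure" where
  "model c f \<theta> \<eta> = density lborel (\<lambda>(x, u, y). ennreal (joint_density c f \<theta> \<eta> x u y))"

definition cond_density ::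
  "real \<Rightarrow> (real \<Rightarrow> real) \<Rightarrow> real^'d \<Rightarrow> real \<Rightarrow> real^'d \<Rightarrow> real^'k \<Rightarrow> real^'d \<Rightarrow> real" where
  "cond_density c f \<theta> \<eta> x u y =
     joint_density c f \<theta> \<eta> x u y / (LINT y'|lborel. joint_density c f \<theta> \<eta> x u y')"

text \<open>A predictive density \<open>q x u y\<close> stands for \<open>q(y; x, u)\<close>.\<close>

definition predictive_density :: "(real^'d \<Rightarrow> real^'k \<Rightarrow> real^'d \<Rightarrow> real) \<Rightarrow> bool" where
  "predictive_density q \<longleftrightarrow>
     (\<lambda>(x, u, y). q x u y) \<in> borel_measurable borel \<and>
     (\<forall>x u y. 0 \<le> q x u y) \<and>
     (\<forall>x u. (\<integral>\<^sup>+ y. ennreal (q x u y) \<partial>lborel) = 1)"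

text \<open>The logarithm of \<open>a / b\<close> for densities, equal to \<open>\<infinity>\<close> where \<open>b\<close> vanishes and \<open>a\<close> does not.
  The case \<open>a = 0\<close> has probability zero under the model, so its value is immaterial.\<close>

definition log_ratio :: "real \<Rightarrow> real \<Rightarrow> ereal" where
  "log_ratio a b = (if 0 < a \<and> b = 0 then \<infinity> else ereal (ln (a / b)))"

text \<open>Positive part minus negative part; \<open>e2ennreal\<close> sends negative values to \<open>0\<close>. Since
  \<open>\<infinity> - \<infinity> = \<infinity>\<close> in \<open>ereal\<close>, a finite value means that both parts are finite.\<close>

definition ext_expectation :: "'a measure \<Rightarrow> ('a \<Rightarrow> ereal) \<Rightarrow> ereal" where
  "ext_expectation M g =
     enn2ereal (\<integral>\<^sup>+ w. e2ennreal (g w) \<partial>M) - enn2ereal (\<integral>\<^sup>+ w. e2ennreal (- g w) \<partial>M)"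

definition KL_risk ::
  "real \<Rightarrow> (real \<Rightarrow> real) \<Rightarrow> real^'d \<Rightarrow> real \<Rightarrow> (real^'d \<Rightarrow> real^'k \<Rightarrow> real^'d \<Rightarrow> real) \<Rightarrow> ereal" where
  "KL_risk c f \<theta> \<eta> q =
     ext_expectation (model c f \<theta> \<eta>)
       (\<lambda>(x, u, y). log_ratio (cond_density c f \<theta> \<eta> x u y) (q x u y))"

definition finite_risk ::
  "real \<Rightarrow> (real \<Rightarrow> real) \<Rightarrow> (real^'d \<Rightarrow> real^'k \<Rightarrow> real^'d \<Rightarrow> real) \<Rightarrow> bool" where
  "finite_risk c f q \<longleftrightarrow> (\<forall>\<theta>. \<forall>\<eta>>0. \<bar>KL_risk c f \<theta> \<eta> q\<bar> \<noteq> \<infinity>)"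

definition dominates ::
  "real \<Rightarrow> (real \<Rightarrow> real) \<Rightarrow> (real^'d \<Rightarrow> real^'k \<Rightarrow> real^'d \<Rightarrow> real) \<Rightarrow>
     (real^'d \<Rightarrow> real^'k \<Rightarrow> real^'d \<Rightarrow> real) \<Rightarrow> bool" where
  "dominates c f q1 q0 \<longleftrightarrow>
     (\<forall>\<theta>. \<forall>\<eta>>0. KL_risk c f \<theta> \<eta> q1 \<le> KL_risk c f \<theta> \<eta> q0) \<and>
     (\<exists>\<theta>. \<exists>\<eta>>0. KL_risk c f \<theta> \<eta> q1 < KL_risk c f \<theta> \<eta> q0)"

end

theory Submission
  imports Defs
begin

text \<open>The entropy term of the model cancels in the difference of two risks, so the difference is the
  expectation of \<open>h = ln q0 - ln q1\<close>, a function that does not depend on \<open>f\<close>. A scale mixture of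
  normals with parameter \<open>\<eta>\<close> is the mixture over \<open>z\<close> of normal models with parameter \<open>\<eta> / z\<close>; by
  Fubini its risk difference is the \<open>G\<close>-average of the normal risk differences \<open>D (\<eta> / z)\<close>, which are
  nonpositive. For strictness, \<open>D\<close> is up to a power of \<open>\<eta>\<close> a Laplace transform, hence continuous, so
  it is negative on an interval around some \<open>\<eta>0\<close>; as \<open>\<eta>\<close> varies over the positive rationals, the
  sets of \<open>z\<close> with \<open>\<eta> / z\<close> in that interval cover \<open>(0,\<infinity>)\<close>, so one of them has positive
  \<open>G\<close>-measure.\<close>

section \<open>Extended expectations with a finite value\<close>

text \<open>Since \<infinity> - \<infinity> is \<infinity> in \<open>ereal\<close>, a finite
  difference forces both parts to be finite. Up to a null set they are then the parts of the real
  function \<open>real_of_ereal (g w)\<close>, so finite risks can be handled as Bochner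
  integrals.\<close>

lemma finite_ext_expectation:
  assumes [measurable]: "g \<in> borel_measurable M" and fin: "\<bar>ext_expectation M g\<bar> \<noteq> \<infinity>"
  shows "AE w in M. \<bar>g w\<bar> \<noteq> \<infinity>"
    and "integrable M (\<lambda>w. real_of_ereal (g w))"
    and "ext_expectation M g = ereal (LINT w|M. real_of_ereal (g w))"
proof -
  let ?A = "\<integral>\<^sup>+ w. e2ennreal (g w) \<partial>M" and ?B = "\<integral>\<^sup>+ w. e2ennreal (- g w) \<partial>M"
  have A: "?A \<noteq> \<infinity>" and B: "?B \<noteq> \<infinity>"
    using fin unfolding ext_expectation_def
    by (cases ?A; cases ?B; auto simp: enn2ereal_ennreal top_ennreal.rep_eq)+
  have "AE w in M. e2ennreal (g w) \<noteq> \<infinity>" "AE w in M. e2ennreal (- g w) \<noteq> \<infinity>"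
    by (rule nn_integral_PInf_AE[OF _ A], simp) (rule nn_integral_PInf_AE[OF _ B], simp)
  then show AE: "AE w in M. \<bar>g w\<bar> \<noteq> \<infinity>"
  proof eventually_elim
    case (elim w)
    then show ?case by (cases "g w") auto
  qed
  have A': "?A = (\<integral>\<^sup>+ w. ennreal (real_of_ereal (g w)) \<partial>M)"
    and B': "?B = (\<integral>\<^sup>+ w. ennreal (- real_of_ereal (g w)) \<partial>M)"
    using AE by (auto intro!: nn_integral_cong_AE simp: ennreal.abs_eq)
  show int: "integrable M (\<lambda>w. real_of_ereal (g w))"
    using A B unfolding A' B' by (subst real_integrable_def) auto
  show "ext_expectation M g = ereal (LINT w|M. real_of_ereal (g w))"
    using A B unfolding ext_expectation_def real_lebesgue_integral_def[OF int] A' B'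
    by (cases ?A; cases ?B; auto simp: A'[symmetric] B'[symmetric] enn2ereal_ennreal)
qed

section \<open>Radial location-scale densities\<close>

text \<open>Treating (x, u, y) as one vector of dimension 2d + k merges the three squared norms into
  one, so that mixing and continuity can be studied on an arbitrary Euclidean space.\<close>

definition location_scale :: "(real \<Rightarrow> real) \<Rightarrow> 'v::euclidean_space \<Rightarrow> real \<Rightarrow> 'v \<Rightarrow> real" where
  "location_scale f m \<eta> w = \<eta> powr (real DIM('v) / 2) * f (\<eta> * (norm (w - m))\<^sup>2)"

text \<open>The substitution \<open>v = sqrt \<eta> *\<^sub>R (w - m)\<close> has a Jacobian equal
  to the prefactor, which reduces the total mass to that of \<open>f\<close>.\<close>

lemma
  fixes m :: "'v::euclidean_space"
  assumes f: "radial_density TYPE('v) f" and \<eta>: "\<eta> > 0"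
  shows borel_measurable_location_scale: "location_scale f m \<eta> \<in> borel_measurable borel"
    and location_scale_nonneg: "0 \<le> location_scale f m \<eta> w"
    and nn_integral_location_scale: "(\<integral>\<^sup>+ w. ennreal (location_scale f m \<eta> w) \<partial>lborel) = 1"
proof -
  have [measurable]: "(\<lambda>t::'v. f ((norm t)\<^sup>2)) \<in> borel_measurable borel"
    and nonneg: "\<And>t. t \<ge> 0 \<Longrightarrow> f t \<ge> 0" and one: "(\<integral>\<^sup>+ t. ennreal (f ((norm (t::'v))\<^sup>2)) \<partial>lborel) = 1"
    using f by (auto simp: radial_density_def)
  have eq: "location_scale f m \<eta> w =
      \<eta> powr (real DIM('v) / 2) * f ((norm (sqrt \<eta> *\<^sub>R (w - m)))\<^sup>2)" for w
    using \<eta> by (simp add: location_scale_def power_mult_distrib)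
  have "(\<lambda>w. f ((norm (sqrt \<eta> *\<^sub>R (w - m)))\<^sup>2)) \<in> borel_measurable borel"
    by (rule measurable_compose[of "\<lambda>w. sqrt \<eta> *\<^sub>R (w - m)" borel borel "\<lambda>t. f ((norm t)\<^sup>2)"]) measurable
  then show [measurable]: "location_scale f m \<eta> \<in> borel_measurable borel"
    unfolding eq[abs_def] by measurable
  show "0 \<le> location_scale f m \<eta> w"
    unfolding location_scale_def using \<eta> by (intro mult_nonneg_nonneg nonneg) auto
  have pow: "\<bar>1 / sqrt \<eta>\<bar> ^ DIM('v) * \<eta> powr (real DIM('v) / 2) = 1"
  proof -
    have "\<eta> powr (real DIM('v) / 2) = sqrt \<eta> ^ DIM('v)"
      using \<eta> by (simp add: powr_half_sqrt[symmetric] powr_realpow[symmetric] powr_powr)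
    then show ?thesis using \<eta> by (simp add: power_divide)
  qed
  have "(\<integral>\<^sup>+ w. ennreal (location_scale f m \<eta> w) \<partial>lborel) =
     (\<integral>\<^sup>+ w. ennreal (location_scale f m \<eta> w)
        \<partial>density (distr lborel borel (\<lambda>x. m + (1 / sqrt \<eta>) *\<^sub>R x)) (\<lambda>_. ennreal (\<bar>1 / sqrt \<eta>\<bar> ^ DIM('v))))"
    using \<eta> by (subst lborel_affine[of "1 / sqrt \<eta>" m]) auto
  also have "\<dots> = (\<integral>\<^sup>+ v. ennreal (\<bar>1 / sqrt \<eta>\<bar> ^ DIM('v)) *
      ennreal (location_scale f m \<eta> (m + (1 / sqrt \<eta>) *\<^sub>R v)) \<partial>lborel)"
    by (simp add: nn_integral_density nn_integral_distr)
  also have "\<dots> = (\<integral>\<^sup>+ v. ennreal (f ((norm (v::'v))\<^sup>2)) \<partial>lborel)"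
  proof (rule nn_integral_cong)
    fix v :: 'v
    have "\<bar>1 / sqrt \<eta>\<bar> ^ DIM('v) * location_scale f m \<eta> (m + (1 / sqrt \<eta>) *\<^sub>R v)
        = f ((norm v)\<^sup>2)"
      using \<eta> pow by (simp add: eq mult.assoc[symmetric])
    then show "ennreal (\<bar>1 / sqrt \<eta>\<bar> ^ DIM('v)) * ennreal (location_scale f m \<eta> (m + (1 / sqrt \<eta>) *\<^sub>R v))
        = ennreal (f ((norm v)\<^sup>2))"
      by (metis ennreal_mult'' zero_le_power abs_ge_zero ennreal_mult')
  qed
  finally show "(\<integral>\<^sup>+ w. ennreal (location_scale f m \<eta> w) \<partial>lborel) = 1" by (simp add: one)
qed

text \<open>The squared norm is a sum of squared coordinates, so the density factorises and its
  integral is a product of one-dimensional normal integrals.\<close>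

lemma radial_density_normal_gen: "radial_density TYPE('v::euclidean_space) (normal_gen DIM('v))"
proof -
  have "ennreal (normal_gen DIM('v) ((norm t)\<^sup>2)) =
      (\<Prod>b\<in>Basis. ennreal (std_normal_density (t \<bullet> b)))" for t :: 'v
  proof -
    have "(2 * pi) powr (- real DIM('v) / 2) = (1 / sqrt (2 * pi)) ^ DIM('v)"
      by (simp add: powr_half_sqrt[symmetric] powr_realpow[symmetric] powr_powr power_divide powr_minus_divide)
    moreover have "exp (- (norm t)\<^sup>2 / 2) = (\<Prod>b\<in>Basis. exp (- (t \<bullet> b)\<^sup>2 / 2))"
      unfolding power2_norm_eq_inner
      by (subst euclidean_inner) (simp add: exp_sum[symmetric] sum_negf sum_divide_distrib power2_eq_square)
    ultimately have "normal_gen DIM('v) ((norm t)\<^sup>2) = (\<Prod>b\<in>Basis. std_normal_density (t \<bullet> b))"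
      by (simp add: normal_gen_def std_normal_density_def prod.distrib prod_dividef power_divide)
    then show ?thesis by (simp add: prod_ennreal)
  qed
  moreover have "(\<integral>\<^sup>+ t. ennreal (std_normal_density t) \<partial>lborel) = 1"
    by (simp add: nn_integral_eq_integral)
  ultimately have "(\<integral>\<^sup>+ t. ennreal (normal_gen DIM('v) ((norm (t::'v))\<^sup>2)) \<partial>lborel) = 1"
    by (simp add: nn_integral_lborel_prod[where f="\<lambda>_ x. ennreal (std_normal_density x)"])
  then show ?thesis
    by (auto simp: radial_density_def normal_gen_def)
qed

section \<open>Normal scale mixtures as averages over the scale\<close>

text \<open>The left side is largest at \<open>v = a / b\<close>, where it equals the bound. The
  inequality is \<open>ln s \<le> s - 1\<close> at \<open>s = v * b / a\<close>, multiplied by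
  \<open>a\<close> and exponentiated.\<close>

lemma powr_mult_exp_bounded:
  fixes a b v :: real
  assumes "a > 0" "b > 0" "v > 0"
  shows "v powr a * exp (- b * v) \<le> exp (a * ln (a / b) - a)"
proof -
  have "ln (v * b / a) \<le> v * b / a - 1" using assms by (intro ln_le_minus_one) auto
  then have "a * (ln v + ln b - ln a) \<le> a * (v * b / a - 1)"
    using assms by (intro mult_left_mono) (auto simp: ln_mult ln_div)
  also have "\<dots> = b * v - a" using assms by (simp add: field_simps)
  finally have "a * ln v + (- b * v) \<le> a * ln (a / b) - a"
    using assms by (simp add: ln_div algebra_simps)
  moreover have "v powr a * exp (- b * v) = exp (a * ln v + (- b * v))"
    using assms by (simp only: powr_def exp_add) simp
  ultimately show ?thesis by simp
qed


text \<open>The mixing integral runs over all of \<open>G\<close>, with positivity of the scale kept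
  as an almost sure fact; this keeps indicators out of the Fubini argument.\<close>

locale normal_scale_mixture = G: real_distribution G
  for G :: "real measure" +
  fixes f :: "real \<Rightarrow> real" and n :: nat
  assumes n_pos: "n > 0"
    and G_pos: "AE z in G. z > 0"
    and mixture: "\<And>t. t \<ge> 0 \<Longrightarrow>
      f t = (LINT z|G. z powr (- real n / 2) * normal_gen n (t / z))"
begin

text \<open>In the variable \<open>v = 1 / z\<close> the kernel is a constant times
  \<open>v powr (n / 2) * exp (- (t / 2) * v)\<close>, which \<open>powr_mult_exp_bounded\<close>
  bounds. At \<open>t = 0\<close> the exponential decay is lost and integrability may fail.\<close>

lemma kernel_integrable:
  assumes "t > 0"
  shows "integrable G (\<lambda>z. z powr (- real n / 2) * normal_gen n (t / z))"
proof -
  let ?a = "real n / 2" and ?K = "(2 * pi) powr (- real n / 2)"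
  have "AE z in G. norm (z powr (- real n / 2) * normal_gen n (t / z))
      \<le> ?K * exp (?a * ln (?a / (t / 2)) - ?a)"
    using G_pos
  proof eventually_elim
    case (elim z)
    have "(1 / z) powr ?a * exp (- (t / 2) * (1 / z)) \<le> exp (?a * ln (?a / (t / 2)) - ?a)"
      using assms elim n_pos by (intro powr_mult_exp_bounded) auto
    moreover have "(1 / z) powr ?a = z powr (- real n / 2)"
      using elim by (simp add: powr_divide powr_minus_divide)
    ultimately have "?K * (z powr (- real n / 2) * exp (- (t / 2) * (1 / z)))
        \<le> ?K * exp (?a * ln (?a / (t / 2)) - ?a)"
      by (intro mult_left_mono) auto
    then show ?case by (simp add: normal_gen_def abs_mult mult_ac)
  qed
  then show ?thesis
    by (rule G.integrable_const_bound) (simp add: normal_gen_def)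
qed

text \<open>The kernel is positive for almost every \<open>z\<close> and \<open>G\<close> has mass
  one. Positivity of \<open>f\<close> is what later makes the logarithm of the conditional density
  meaningful.\<close>

lemma mixture_pos:
  assumes "t > 0"
  shows "f t > 0"
proof -
  have "(LINT z|G. 0) < (LINT z|G. z powr (- real n / 2) * normal_gen n (t / z))"
  proof (rule G.integral_less_AE_space)
    show "AE z in G. 0 < z powr (- real n / 2) * normal_gen n (t / z)"
      using G_pos by eventually_elim (simp add: normal_gen_def)
    show "emeasure G (space G) \<noteq> 0" by (simp add: G.emeasure_space_1 del: G.space_eq_univ)
  qed (simp, rule kernel_integrable[OF assms])
  then show ?thesis using mixture[of t] assms by simp
qed

text \<open>The powers of \<open>\<eta>\<close> and \<open>z\<close> combine to the normalising
  factor for \<open>\<eta> / z\<close>, so each \<open>z\<close> contributes a genuine normal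
  density. The centre is excluded because there the argument of \<open>f\<close> is 0.\<close>

lemma location_scale_mixture:
  fixes m w :: "'v::euclidean_space"
  assumes dim: "DIM('v) = n" and "\<eta> > 0" "w \<noteq> m"
  shows "integrable G (\<lambda>z. location_scale (normal_gen n) m (\<eta> / z) w)"
    and "location_scale f m \<eta> w = (LINT z|G. location_scale (normal_gen n) m (\<eta> / z) w)"
proof -
  let ?t = "\<eta> * (norm (w - m))\<^sup>2"
  let ?k = "\<lambda>z. \<eta> powr (real n / 2) *
    (z powr (- real n / 2) * normal_gen n (?t / z))"
  have t: "?t > 0" using assms by simp
  have eq: "AE z in G. ?k z = location_scale (normal_gen n) m (\<eta> / z) w"
    using G_pos
  proof eventually_elim
    case (elim z)
    then show ?case using assms
      by (simp add: location_scale_def dim powr_divide powr_minus_divide)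
  qed
  have int: "integrable G ?k" by (intro integrable_mult_right kernel_integrable t)
  have meas: "(\<lambda>z. location_scale (normal_gen n) m (\<eta> / z) w) \<in> borel_measurable G"
    unfolding location_scale_def normal_gen_def by measurable
  show "integrable G (\<lambda>z. location_scale (normal_gen n) m (\<eta> / z) w)"
    by (rule integrable_cong_AE_imp[OF int meas eq])
  have "location_scale f m \<eta> w = (LINT z|G. ?k z)"
    using t by (simp add: location_scale_def dim mixture)
  also have "\<dots> = (LINT z|G. location_scale (normal_gen n) m (\<eta> / z) w)"
    by (rule integral_cong_AE[OF borel_measurable_integrable[OF int] meas eq])
  finally show "location_scale f m \<eta> w = \<dots>" .
qed

text \<open>Fubini for Lebesgue measure and \<open>G\<close>; the exceptional point
  \<open>w = m\<close> is a null set.\<close>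

lemma expectation_mixture:
  fixes m :: "'v::euclidean_space" and h :: "'v \<Rightarrow> real"
  assumes dim: "DIM('v) = n" and \<eta>: "\<eta> > 0" and [measurable]: "h \<in> borel_measurable borel"
    and int: "integrable lborel (\<lambda>w. location_scale f m \<eta> w * h w)"
  defines "D \<equiv> \<lambda>\<zeta>. LINT w|lborel. location_scale (normal_gen n) m \<zeta> w * h w"
  shows "integrable G (\<lambda>z. D (\<eta> / z))"
    and "(LINT w|lborel. location_scale f m \<eta> w * h w) = (LINT z|G. D (\<eta> / z))"
proof -
  interpret P: pair_sigma_finite lborel G
    by (simp add: pair_sigma_finite_def lborel.sigma_finite_measure_axioms G.sigma_finite_measure_axioms)
  let ?p = "\<lambda>w z. location_scale (normal_gen n) m (\<eta> / z) w"
  have nonneg: "?p w z \<ge> 0" for w z by (simp add: location_scale_def normal_gen_def)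
  have AE: "AE w in lborel. w \<noteq> m" by (rule AE_lborel_singleton)
  have meas: "(\<lambda>(w, z). ?p w z * h w) \<in> borel_measurable (lborel \<Otimes>\<^sub>M G)"
    unfolding location_scale_def normal_gen_def by measurable
  \<comment> \<open>The kernel is nonnegative, so integrating the absolute value over
    \<open>z\<close> first gives back \<open>\<bar>location_scale f m \<eta> w * h w\<bar>\<close>
    almost everywhere, which is integrable by hypothesis. This yields joint integrability.\<close>
  have "integrable lborel (\<lambda>w. LINT z|G. norm (?p w z * h w))"
  proof (rule integrable_cong_AE_imp[OF integrable_abs[OF int]])
    show "(\<lambda>w. LINT z|G. norm (?p w z * h w)) \<in> borel_measurable lborel"
      unfolding location_scale_def normal_gen_def by measurable
    show "AE w in lborel. \<bar>location_scale f m \<eta> w * h w\<bar> = (LINT z|G. norm (?p w z * h w))"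
      using AE
    proof eventually_elim
      case (elim w)
      have "(LINT z|G. ?p w z) \<ge> 0" by (simp add: nonneg)
      then show ?case
        by (simp add: abs_mult nonneg location_scale_mixture(2)[OF dim \<eta> elim])
    qed
  qed
  moreover have "AE w in lborel. integrable G (\<lambda>z. ?p w z * h w)"
    using AE by eventually_elim (intro integrable_mult_left location_scale_mixture dim \<eta>)
  ultimately have pair: "integrable (lborel \<Otimes>\<^sub>M G) (\<lambda>(w, z). ?p w z * h w)"
    by (intro P.Fubini_integrable meas) simp_all
  show "integrable G (\<lambda>z. D (\<eta> / z))"
    using P.integrable_snd[OF pair] by (simp add: D_def)
  have "(LINT w|lborel. location_scale f m \<eta> w * h w) = (LINT w|lborel. LINT z|G. ?p w z * h w)"
  proof (rule integral_cong_AE)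
    show "AE w in lborel. location_scale f m \<eta> w * h w = (LINT z|G. ?p w z * h w)"
      using AE by eventually_elim (simp add: location_scale_mixture(2)[OF dim \<eta>])
    show "(\<lambda>w. location_scale f m \<eta> w * h w) \<in> borel_measurable lborel"
      using int by (rule borel_measurable_integrable)
    show "(\<lambda>w. LINT z|G. ?p w z * h w) \<in> borel_measurable lborel"
      unfolding location_scale_def normal_gen_def by measurable
  qed
  then show "(LINT w|lborel. location_scale f m \<eta> w * h w) = (LINT z|G. D (\<eta> / z))"
    using P.Fubini_integral[OF pair] by (simp add: D_def)
qed

end

section \<open>Continuity and sign in the scale parameter\<close>

text \<open>Dominated convergence: as \<open>s\<close> is nonnegative, the integrand at the left
  endpoint \<open>a\<close> dominates those at all larger parameters.\<close>

lemma continuous_on_Laplace: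
  fixes s h :: "'a \<Rightarrow> real"
  assumes [measurable]: "s \<in> borel_measurable M" "h \<in> borel_measurable M"
    and nonneg: "\<And>w. s w \<ge> 0"
    and int: "integrable M (\<lambda>w. exp (- a * s w) * h w)"
  shows "continuous_on {a..} (\<lambda>\<eta>. LINT w|M. exp (- \<eta> * s w) * h w)"
  unfolding continuous_on_sequentially comp_def
proof (intro allI ballI impI, elim conjE)
  fix x :: "nat \<Rightarrow> real" and b
  assume x: "\<forall>n. x n \<in> {a..}" and lim: "x \<longlonglongrightarrow> b"
  show "(\<lambda>n. LINT w|M. exp (- x n * s w) * h w) \<longlonglongrightarrow> (LINT w|M. exp (- b * s w) * h w)"
  proof (rule integral_dominated_convergence[where w="\<lambda>w. \<bar>exp (- a * s w) * h w\<bar>"])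
    show "AE w in M. (\<lambda>n. exp (- x n * s w) * h w) \<longlonglongrightarrow> exp (- b * s w) * h w"
      by (intro AE_I2 tendsto_intros lim)
    show "AE w in M. norm (exp (- x n * s w) * h w) \<le> \<bar>exp (- a * s w) * h w\<bar>" for n
      using x nonneg by (intro AE_I2) (auto simp: abs_mult intro!: mult_right_mono)
  qed (use int in auto)
qed

lemma isCont_normal_expectation:
  fixes m :: "'v::euclidean_space" and h :: "'v \<Rightarrow> real"
  assumes "\<eta> > 0" and [measurable]: "h \<in> borel_measurable borel"
    and int: "\<And>\<zeta>. \<zeta> > 0 \<Longrightarrow> integrable lborel (\<lambda>w. location_scale (normal_gen DIM('v)) m \<zeta> w * h w)"
  shows "isCont (\<lambda>\<zeta>. LINT w|lborel. location_scale (normal_gen DIM('v)) m \<zeta> w * h w) \<eta>"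
proof -
  let ?s = "\<lambda>w. (norm (w - m))\<^sup>2 / 2" and ?K = "(2 * pi) powr (- real DIM('v) / 2)"
  let ?H = "\<lambda>\<zeta>. LINT w|lborel. exp (- \<zeta> * ?s w) * h w"
  have eq: "location_scale (normal_gen DIM('v)) m \<zeta> w * h w =
      (\<zeta> powr (real DIM('v) / 2) * ?K) * (exp (- \<zeta> * ?s w) * h w)" for \<zeta> w
    by (simp add: location_scale_def normal_gen_def)
  \<comment> \<open>The endpoint \<open>\<eta> / 2\<close> is still positive, so \<open>int\<close>
    applies, and it leaves \<open>\<eta>\<close> in the interior of the half-line of
    continuity.\<close>
  have "integrable lborel (\<lambda>w. ((\<eta> / 2) powr (real DIM('v) / 2) * ?K) * (exp (- (\<eta> / 2) * ?s w) * h w))"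
    unfolding eq[symmetric] using assms(1) by (intro int) simp
  then have "integrable lborel (\<lambda>w. exp (- (\<eta> / 2) * ?s w) * h w)"
    unfolding integrable_mult_right_iff using assms(1) by auto
  then have "continuous_on {\<eta> / 2..} ?H" by (intro continuous_on_Laplace) auto
  then have "isCont ?H \<eta>"
    by (rule continuous_on_interior) (use assms(1) in auto)
  then show ?thesis
    unfolding eq integral_mult_right_zero using assms(1) by (intro continuous_intros) auto
qed

text \<open>If no average were negative, each nonpositive integrand would vanish almost surely.
  Moving \<open>\<eta>\<close> through the rationals brings \<open>\<eta> / Z z\<close> near
  \<open>\<eta>0\<close> for every \<open>z\<close>, where \<open>D\<close> is negative.\<close>

lemma (in prob_space) scale_average_neg:
  fixes D :: "real \<Rightarrow> real"
  assumes pos: "AE z in M. Z z > 0"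
    and int: "\<And>\<eta>. \<eta> > 0 \<Longrightarrow> integrable M (\<lambda>z. D (\<eta> / Z z))"
    and nonpos: "\<And>\<eta>. \<eta> > 0 \<Longrightarrow> D \<eta> \<le> 0"
    and \<eta>0: "\<eta>0 > 0" "D \<eta>0 < 0" "isCont D \<eta>0"
  shows "\<exists>\<eta>>0. (LINT z|M. D (\<eta> / Z z)) < 0"
proof (rule ccontr)
  assume neg: "\<not> ?thesis"
  have zero: "AE z in M. D (\<eta> / Z z) = 0" if "\<eta> > 0" for \<eta>
  proof -
    have le: "AE z in M. 0 \<le> - D (\<eta> / Z z)"
      using pos by eventually_elim (use nonpos that in auto)
    have "(LINT z|M. - D (\<eta> / Z z)) \<ge> 0"
      using le by (rule integral_nonneg_AE)
    then have "(LINT z|M. - D (\<eta> / Z z)) = 0"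
      using neg that by force
    then show ?thesis
      using integral_nonneg_eq_0_iff_AE[OF _ le] int[OF that] by auto
  qed
  have "eventually (\<lambda>\<zeta>. D \<zeta> < 0) (nhds \<eta>0)"
    using \<eta>0 by (intro order_tendstoD[of D "D \<eta>0"]) (auto simp: isCont_def tendsto_nhds_iff)
  then obtain e where e: "e > 0" "\<And>\<zeta>. \<bar>\<zeta> - \<eta>0\<bar> < e \<Longrightarrow> D \<zeta> < 0"
    by (auto simp: eventually_nhds_metric dist_real_def)
  \<comment> \<open>The null set in \<open>zero\<close> depends on \<open>\<eta>\<close>, so only
    countably many values can be treated at once.\<close>
  have "AE z in M. \<forall>r\<in>\<rat> \<inter> {0<..}. D (r / Z z) = 0"
    using zero countable_rat by (subst AE_ball_countable) (auto intro: countable_subset)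
  then have "AE z in M. False"
    using pos
  proof eventually_elim
    case (elim z)
    \<comment> \<open>Chosen so that \<open>r / Z z\<close> lies strictly between
      \<open>\<eta>0\<close> and \<open>\<eta>0 + e\<close>.\<close>
    obtain r where r: "r \<in> \<rat>" "\<eta>0 * Z z < r" "r < (\<eta>0 + e) * Z z"
      using Rats_dense_in_real[of "\<eta>0 * Z z" "(\<eta>0 + e) * Z z"] elim e by auto
    have "0 < \<eta>0 * Z z" using elim \<eta>0 by simp
    then have "r > 0" using r by linarith
    then have "D (r / Z z) = 0" using elim r by auto
    moreover have "\<eta>0 < r / Z z" "r / Z z < \<eta>0 + e"
      using r elim by (simp_all add: pos_less_divide_eq pos_divide_less_eq)
    ultimately show False using e(2)[of "r / Z z"] by auto
  qed
  then show False by simp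
qed


section \<open>Conditional densities and risk differences\<close>

lemma joint_density_eq_location_scale:
  fixes x \<theta> y :: "real^'d" and u :: "real^'k"
  shows "joint_density c f \<theta> \<eta> x u y = location_scale f (\<theta>, 0, c *\<^sub>R \<theta>) \<eta> (x, u, y)"
proof -
  have "real DIM((real^'d) \<times> (real^'k) \<times> (real^'d)) / 2 = real CARD('d) + real CARD('k) / 2"
    by simp
  moreover have "(norm ((x, u, y) - (\<theta>, 0, c *\<^sub>R \<theta>)))\<^sup>2 =
      (norm (x - \<theta>))\<^sup>2 + (norm u)\<^sup>2 + (norm (y - c *\<^sub>R \<theta>))\<^sup>2"
    by (simp add: norm_Pair)
  ultimately show ?thesis by (simp only: joint_density_def location_scale_def)
qed

text \<open>The danger is a denominator equal to 0, including the default value of a divergent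
  integral. The joint density has total mass one, so by Tonelli its \<open>y\<close>-integral is
  finite for almost all (x, u); it is positive because the integrand vanishes at most at one
  point.\<close>

lemma
  fixes \<theta> :: "real^'d" and f :: "real \<Rightarrow> real"
  assumes f: "radial_density TYPE((real^'d) \<times> (real^'k) \<times> (real^'d)) f"
    and pos: "\<And>t. t > 0 \<Longrightarrow> f t > 0" and \<eta>: "\<eta> > 0"
  shows borel_measurable_cond_density:
      "(\<lambda>(x, u, y). cond_density c f \<theta> \<eta> x (u :: real^'k) y) \<in> borel_measurable borel"
    and AE_cond_density_pos:
      "AE (x, u, y) in lborel. cond_density c f \<theta> \<eta> x (u :: real^'k) y > 0"
proof -
  let ?m = "(\<theta>, 0, c *\<^sub>R \<theta>) :: (real^'d) \<times> (real^'k) \<times> (real^'d)"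
  let ?p = "location_scale f ?m \<eta>"
  have [measurable]: "(fst :: (real^'d) \<times> (real^'k) \<times> (real^'d) \<Rightarrow> _) \<in> borel_measurable borel"
    "(snd :: (real^'d) \<times> (real^'k) \<times> (real^'d) \<Rightarrow> _) \<in> borel_measurable borel"
    "(fst :: (real^'k) \<times> (real^'d) \<Rightarrow> _) \<in> borel_measurable borel"
    "(snd :: (real^'k) \<times> (real^'d) \<Rightarrow> _) \<in> borel_measurable borel"
    by (intro borel_measurable_continuous_onI continuous_intros)+
  have p_meas [measurable]: "?p \<in> borel_measurable borel"
    by (rule borel_measurable_location_scale[OF f \<eta>])
  have nonneg: "?p w \<ge> 0" for w by (rule location_scale_nonneg[OF f \<eta>])
  have p_pos: "?p w > 0" if "w \<noteq> ?m" for w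
    using that \<eta> by (auto simp: location_scale_def intro!: mult_pos_pos pos)
  have eq: "cond_density c f \<theta> \<eta> x u y = ?p (x, u, y) / (LINT y'|lborel. ?p (x, u, y'))" for x u y
    by (simp add: cond_density_def joint_density_eq_location_scale)
  show meas: "(\<lambda>(x, u, y). cond_density c f \<theta> \<eta> x (u :: real^'k) y) \<in> borel_measurable borel"
  proof -
    \<comment> \<open>Measurability of a parameter integral is stated over a product measure,
      whereas continuity gives measurability for the Borel sets of the product space; the two
      sigma-algebras agree.\<close>
    have "sets (borel \<Otimes>\<^sub>M lborel) =
        sets (borel :: (((real^'d) \<times> (real^'k) \<times> (real^'d)) \<times> (real^'d)) measure)"
      by (simp add: borel_prod[symmetric] cong: sets_pair_measure_cong)
    moreover have "(\<lambda>v. (fst (fst v), fst (snd (fst v)), snd v)) \<in>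
        borel_measurable (borel :: (((real^'d) \<times> (real^'k) \<times> (real^'d)) \<times> (real^'d)) measure)"
      by (intro borel_measurable_continuous_onI continuous_intros)
    ultimately have "(\<lambda>v. (fst (fst v), fst (snd (fst v)), snd v)) \<in>
        borel_measurable ((borel :: ((real^'d) \<times> (real^'k) \<times> (real^'d)) measure) \<Otimes>\<^sub>M (lborel :: (real^'d) measure))"
      by (simp cong: measurable_cong_sets)
    then have "(\<lambda>(w :: (real^'d) \<times> (real^'k) \<times> (real^'d), y). ?p (fst w, fst (snd w), y))
        \<in> borel_measurable (borel \<Otimes>\<^sub>M lborel)"
      unfolding case_prod_beta by (rule measurable_compose[OF _ p_meas])
    then have [measurable]: "(\<lambda>w :: (real^'d) \<times> (real^'k) \<times> (real^'d).
        LINT y|lborel. ?p (fst w, fst (snd w), y)) \<in> borel_measurable borel"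
      by (rule lborel.borel_measurable_lebesgue_integral)
    show ?thesis unfolding eq case_prod_beta by measurable
  qed
  have "(\<integral>\<^sup>+ x. \<integral>\<^sup>+ u. \<integral>\<^sup>+ y. ennreal (?p (x, u, y)) \<partial>lborel \<partial>lborel \<partial>lborel) = 1"
  proof -
    have "(\<integral>\<^sup>+ u. \<integral>\<^sup>+ y. ennreal (?p (x, u, y)) \<partial>lborel \<partial>lborel) = (\<integral>\<^sup>+ v. ennreal (?p (x, v)) \<partial>lborel)" for x
      by (subst lborel.nn_integral_fst) (simp_all add: lborel_prod)
    moreover have "(\<integral>\<^sup>+ x. \<integral>\<^sup>+ v. ennreal (?p (x, v)) \<partial>lborel \<partial>lborel) = (\<integral>\<^sup>+ w. ennreal (?p w) \<partial>lborel)"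
      by (subst lborel.nn_integral_fst) (simp_all add: lborel_prod)
    ultimately show ?thesis using nn_integral_location_scale[OF f \<eta>, of ?m] by simp
  qed
  then have "AE x in lborel. (\<integral>\<^sup>+ u. \<integral>\<^sup>+ y. ennreal (?p (x, u, y)) \<partial>lborel \<partial>lborel) \<noteq> \<infinity>"
    by (intro nn_integral_PInf_AE) auto
  then have "AE x in lborel. AE u in lborel. AE y in lborel. cond_density c f \<theta> \<eta> x (u :: real^'k) y > 0"
  proof eventually_elim
    case (elim x)
    then have "AE u in lborel. (\<integral>\<^sup>+ y. ennreal (?p (x, u, y)) \<partial>lborel) \<noteq> \<infinity>"
      by (intro nn_integral_PInf_AE) auto
    then show ?case
    proof eventually_elim
      case (elim u)
      have AE: "AE y in lborel. ?p (x, u, y) > 0"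
        using AE_lborel_singleton[of "c *\<^sub>R \<theta>"] by eventually_elim (auto intro: p_pos)
      have int: "integrable lborel (\<lambda>y. ?p (x, u, y))"
        using elim by (intro integrableI_nonneg) (auto simp: nonneg top.not_eq_extremum)
      have "(LINT y|lborel. ?p (x, u, y)) \<noteq> 0"
      proof
        assume "(LINT y|lborel. ?p (x, u, y)) = 0"
        then have "AE y in lborel. ?p (x, u, y) = 0"
          using int by (subst (asm) integral_nonneg_eq_0_iff_AE) (auto simp: nonneg)
        \<comment> \<open>Lebesgue measure is not the null measure, so a false property cannot hold
          almost everywhere.\<close>
        with AE have "AE y in (lborel :: (real^'d) measure). False" by eventually_elim simp
        then show False
          by (simp add: eventually_False ae_filter_eq_bot_iff)
      qed
      moreover have "(LINT y|lborel. ?p (x, u, y)) \<ge> 0" by (simp add: nonneg)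
      ultimately have "0 < (LINT y|lborel. ?p (x, u, y))" by simp
      then show ?case
        using AE by (auto simp: eq elim!: eventually_mono)
    qed
  qed
  \<comment> \<open>Iterated almost-everywhere statements combine into one on the product only for a
    measurable set. So \<open>A\<close> is shown to be Borel, then \<open>u\<close> is joined with
    \<open>y\<close>, and \<open>x\<close> with that pair.\<close>
  moreover define A where "A = {(x, u, y). cond_density c f \<theta> \<eta> x (u :: real^'k) y > 0}"
  ultimately have AE: "AE x in lborel. AE u in lborel. AE y in lborel. (x, u, y) \<in> A" by simp
  have A [measurable]: "A \<in> sets borel"
    using borel_measurable_less[OF borel_measurable_const[of 0] meas]
    by (simp add: A_def case_prod_beta')
  have "AE x in lborel. AE v in lborel \<Otimes>\<^sub>M lborel. (x, v) \<in> A"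
    using AE
  proof eventually_elim
    case (elim x)
    have "(\<lambda>v. (x, v)) -` A \<inter> space borel \<in> sets borel"
      by (rule measurable_sets[OF _ A]) measurable
    then have "{v \<in> space (lborel \<Otimes>\<^sub>M lborel). (x, v) \<in> A} \<in> sets (lborel \<Otimes>\<^sub>M lborel)"
      by (simp only: lborel_prod) (simp add: vimage_def)
    then show ?case using elim by (rule lborel_pair.AE_pair_measure)
  qed
  then have "AE w in lborel \<Otimes>\<^sub>M lborel \<Otimes>\<^sub>M lborel. w \<in> A"
    unfolding lborel_prod using A by (intro lborel_pair.AE_pair_measure[unfolded lborel_prod]) auto
  then show "AE (x, u, y) in lborel. cond_density c f \<theta> \<eta> x (u :: real^'k) y > 0"
    unfolding lborel_prod by (simp add: A_def case_prod_beta')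
qed

text \<open>The logarithm of the conditional density occurs in both risks and cancels pointwise,
  which leaves the same \<open>h\<close> for every \<open>f\<close>. Finite risks permit the
  subtraction of the two integrals.\<close>

lemma
  fixes \<theta> :: "real^'d" and q0 q1 :: "real^'d \<Rightarrow> real^'k \<Rightarrow> real^'d \<Rightarrow> real"
  assumes f: "radial_density TYPE((real^'d) \<times> (real^'k) \<times> (real^'d)) f"
    and pos: "\<And>t. t > 0 \<Longrightarrow> f t > 0" and \<eta>: "\<eta> > 0"
    and q: "predictive_density q0" "predictive_density q1"
    and fin: "finite_risk c f q0" "finite_risk c f q1"
  defines "h \<equiv> \<lambda>(x, u, y). ln (q0 x u y) - ln (q1 x u y)"
  shows integrable_log_ratio_diff:
      "integrable lborel (\<lambda>w. location_scale f (\<theta>, 0, c *\<^sub>R \<theta>) \<eta> w * h w)"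
    and KL_risk_diff: "KL_risk c f \<theta> \<eta> q1 = KL_risk c f \<theta> \<eta> q0 +
      ereal (LINT w|lborel. location_scale f (\<theta>, 0, c *\<^sub>R \<theta>) \<eta> w * h w)"
proof -
  let ?M = "model c f \<theta> \<eta> :: ((real^'d) \<times> (real^'k) \<times> (real^'d)) measure"
  let ?p = "location_scale f (\<theta>, 0, c *\<^sub>R \<theta>) \<eta> :: (real^'d) \<times> (real^'k) \<times> (real^'d) \<Rightarrow> real"
  define L where "L q = (\<lambda>(x, u, y). log_ratio (cond_density c f \<theta> \<eta> x u y) (q x u y))"
    for q :: "real^'d \<Rightarrow> real^'k \<Rightarrow> real^'d \<Rightarrow> real"
  have [measurable]: "?p \<in> borel_measurable borel"
    by (rule borel_measurable_location_scale[OF f \<eta>])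
  have M: "?M = density lborel (\<lambda>w. ennreal (?p w))"
    by (simp add: model_def joint_density_eq_location_scale case_prod_beta')
  have sets_M [measurable_cong]: "sets ?M = sets borel" by (simp add: M)
  note [measurable] = borel_measurable_cond_density[OF f pos \<eta>, of c \<theta>, unfolded case_prod_beta]
  have q_meas [measurable]: "(\<lambda>w. q0 (fst w) (fst (snd w)) (snd (snd w))) \<in> borel_measurable borel"
    "(\<lambda>w. q1 (fst w) (fst (snd w)) (snd (snd w))) \<in> borel_measurable borel"
    using q by (auto simp: predictive_density_def case_prod_beta')
  have [measurable]: "h \<in> borel_measurable borel"
    unfolding h_def case_prod_beta by measurable
  have L_meas: "L q \<in> borel_measurable ?M" 
    if [measurable]: "(\<lambda>w. q (fst w) (fst (snd w)) (snd (snd w))) \<in> borel_measurable borel" for q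
    unfolding L_def log_ratio_def case_prod_beta by measurable
  have KL: "KL_risk c f \<theta> \<eta> q = ext_expectation ?M (L q)" for q
    by (simp add: KL_risk_def L_def)
  have fin': "\<bar>ext_expectation ?M (L q0)\<bar> \<noteq> \<infinity>" "\<bar>ext_expectation ?M (L q1)\<bar> \<noteq> \<infinity>"
    using fin \<eta> by (auto simp: finite_risk_def KL[symmetric])
  note L0 = finite_ext_expectation[OF L_meas[OF q_meas(1)] fin'(1)]
  note L1 = finite_ext_expectation[OF L_meas[OF q_meas(2)] fin'(2)]
  have "AE w in ?M. (case w of (x, u, y) \<Rightarrow> cond_density c f \<theta> \<eta> x u y > 0)"
    using AE_cond_density_pos[OF f pos \<eta>, of c \<theta>] unfolding M
    by (subst AE_density) (auto elim: eventually_mono)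
  moreover have "AE w in ?M. \<bar>L q0 w\<bar> \<noteq> \<infinity>" "AE w in ?M. \<bar>L q1 w\<bar> \<noteq> \<infinity>"
    by (rule L0(1) L1(1))+
  \<comment> \<open>Where the conditional density is positive, a finite \<open>log_ratio\<close>
    excludes a zero predictive density, so each logarithm of a quotient splits.\<close>
  ultimately have eq: "AE w in ?M. real_of_ereal (L q1 w) - real_of_ereal (L q0 w) = h w"
  proof eventually_elim
    case (elim w)
    obtain x u y where w: "w = (x, u, y)" by (cases w)
    have "q0 x u y \<ge> 0" "q1 x u y \<ge> 0" using q by (auto simp: predictive_density_def)
    with elim show ?case
      by (auto simp: w L_def log_ratio_def h_def ln_div split: if_splits)
  qed
  have int: "integrable ?M (\<lambda>w. real_of_ereal (L q1 w) - real_of_ereal (L q0 w))"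
    by (intro Bochner_Integration.integrable_diff L0(2) L1(2))
  have "integrable ?M h"
    by (rule integrable_cong_AE_imp[OF int _ eq]) measurable
  then show "integrable lborel (\<lambda>w. ?p w * h w)"
    unfolding M by (subst (asm) integrable_density) (auto simp: location_scale_nonneg[OF f \<eta>])
  have "(LINT w|lborel. ?p w * h w) = (LINT w|?M. h w)"
    unfolding M by (subst integral_density) (auto simp: location_scale_nonneg[OF f \<eta>])
  also have "\<dots> = (LINT w|?M. real_of_ereal (L q1 w) - real_of_ereal (L q0 w))"
    using eq int by (intro integral_cong_AE) auto
  also have "\<dots> = (LINT w|?M. real_of_ereal (L q1 w)) - (LINT w|?M. real_of_ereal (L q0 w))"
    by (intro Bochner_Integration.integral_diff L0(2) L1(2))
  finally show "KL_risk c f \<theta> \<eta> q1 = KL_risk c f \<theta> \<eta> q0 + ereal (LINT w|lborel. ?p w * h w)"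
    unfolding KL by (simp add: L0(3) L1(3))
qed

section \<open>Transfer of domination to scale mixtures\<close>

text \<open>\<open>cdf G 0 = 0\<close> says that \<open>G\<close> gives no mass to
  \<open>{..0}\<close>, so restricting the integral to positive \<open>z\<close> does not change its
  value.\<close>

lemma scale_mixture_of_normalsE:
  assumes "scale_mixture_of_normals n f" and "n > 0"
  obtains G where "normal_scale_mixture G f n"
proof -
  obtain G where G: "real_distribution G" "cdf G 0 = 0" and
    f: "\<And>t. t \<ge> 0 \<Longrightarrow> f t = (LINT z:{0<..}|G. z powr (- real n / 2) * normal_gen n (t / z))"
    using assms by (auto simp: scale_mixture_of_normals_def)
  interpret real_distribution G by fact
  have pos: "AE z in G. z > 0"
  proof (rule AE_I)
    show "emeasure G {..0} = 0" using G(2) by (simp add: cdf_def emeasure_eq_measure)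
  qed auto
  have "normal_scale_mixture G f n"
  proof
    fix t :: real assume "t \<ge> 0"
    then have "f t = (LINT z:{0<..}|G. z powr (- real n / 2) * normal_gen n (t / z))"
      by (rule f)
    also have "\<dots> = (LINT z|G. z powr (- real n / 2) * normal_gen n (t / z))"
      unfolding set_lebesgue_integral_def normal_gen_def
      using pos by (intro integral_cong_AE) (auto elim!: eventually_mono)
    finally show "f t = (LINT z|G. z powr (- real n / 2) * normal_gen n (t / z))" .
  qed (use pos assms(2) in auto)
  then show ?thesis by (rule that)
qed

theorem theorem4p1:
  fixes c :: real
    and q0 q1 :: "real^'d \<Rightarrow> real^'k \<Rightarrow> real^'d \<Rightarrow> real"
  defines "n \<equiv> 2 * CARD('d) + CARD('k)"
  assumes "c > 0"
    and "predictive_density q0" and "predictive_density q1"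
    and "finite_risk c (normal_gen n) q0" and "finite_risk c (normal_gen n) q1"
    and "dominates c (normal_gen n) q1 q0"
  shows "\<forall>f. radial_density TYPE((real^'d) \<times> (real^'k) \<times> (real^'d)) f \<longrightarrow>
             scale_mixture_of_normals n f \<longrightarrow>
             finite_risk c f q0 \<longrightarrow> finite_risk c f q1 \<longrightarrow>
             dominates c f q1 q0"
proof (intro allI impI)
  fix f assume f: "radial_density TYPE((real^'d) \<times> (real^'k) \<times> (real^'d)) f"
    and mix: "scale_mixture_of_normals n f" and fin: "finite_risk c f q0" "finite_risk c f q1"
  let ?V = "TYPE((real^'d) \<times> (real^'k) \<times> (real^'d))"
  have n: "n = DIM((real^'d) \<times> (real^'k) \<times> (real^'d))" by (simp add: n_def)
  obtain G where "normal_scale_mixture G f n"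
    using mix by (rule scale_mixture_of_normalsE) (simp add: n_def)
  then interpret normal_scale_mixture G f n .
  define h where "h = (\<lambda>(x, u, y). ln (q0 x u y) - ln (q1 x u y))"
  \<comment> \<open>For admissible \<open>g\<close> this is the risk of \<open>q1\<close> minus the
    risk of \<open>q0\<close>; it depends on \<open>g\<close> only through the weight, not through
    \<open>h\<close>.\<close>
  define R where "R g \<theta> \<eta> = (LINT w|lborel. location_scale g (\<theta>, 0, c *\<^sub>R \<theta>) \<eta> w * h w)" for g \<theta> \<eta>
  have h [measurable]: "h \<in> borel_measurable borel"
  proof -
    have [measurable]: "(\<lambda>w. q0 (fst w) (fst (snd w)) (snd (snd w))) \<in> borel_measurable borel"
      "(\<lambda>w. q1 (fst w) (fst (snd w)) (snd (snd w))) \<in> borel_measurable borel"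
      using assms by (auto simp: predictive_density_def case_prod_beta')
    show ?thesis unfolding h_def case_prod_beta by measurable
  qed
  have normal: "radial_density ?V (normal_gen n)" unfolding n by (rule radial_density_normal_gen)
  have normal_pos: "normal_gen n t > 0" for t by (simp add: normal_gen_def)
  \<comment> \<open>A finite \<open>ereal\<close> can be cancelled on both sides, so comparing the
    risks amounts to reading the sign of \<open>R\<close>.\<close>
  have "KL_risk c g \<theta> \<eta> q1 \<le> KL_risk c g \<theta> \<eta> q0 \<longleftrightarrow> R g \<theta> \<eta> \<le> 0"
    and "KL_risk c g \<theta> \<eta> q1 < KL_risk c g \<theta> \<eta> q0 \<longleftrightarrow> R g \<theta> \<eta> < 0"
    if "radial_density ?V g" "\<And>t. t > 0 \<Longrightarrow> g t > 0" "\<eta> > 0" "finite_risk c g q0" "finite_risk c g q1"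
    for g \<theta> \<eta>
  proof -
    have "KL_risk c g \<theta> \<eta> q1 = KL_risk c g \<theta> \<eta> q0 + ereal (R g \<theta> \<eta>)"
      unfolding R_def h_def by (rule KL_risk_diff) (use that assms in auto)
    moreover have "\<bar>KL_risk c g \<theta> \<eta> q0\<bar> \<noteq> \<infinity>" using that by (auto simp: finite_risk_def)
    ultimately show "KL_risk c g \<theta> \<eta> q1 \<le> KL_risk c g \<theta> \<eta> q0 \<longleftrightarrow> R g \<theta> \<eta> \<le> 0"
      and "KL_risk c g \<theta> \<eta> q1 < KL_risk c g \<theta> \<eta> q0 \<longleftrightarrow> R g \<theta> \<eta> < 0"
      by (cases "KL_risk c g \<theta> \<eta> q0"; simp)+
  qed
  then have dominates_iff: "dominates c g q1 q0 \<longleftrightarrow>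
      (\<forall>\<theta>. \<forall>\<eta>>0. R g \<theta> \<eta> \<le> 0) \<and> (\<exists>\<theta>. \<exists>\<eta>>0. R g \<theta> \<eta> < 0)"
    if "radial_density ?V g" "\<And>t. t > 0 \<Longrightarrow> g t > 0" "finite_risk c g q0" "finite_risk c g q1" for g
    using that unfolding dominates_def by (metis (no_types, lifting))
  have R_nonpos: "\<And>\<theta> \<eta>. \<eta> > 0 \<Longrightarrow> R (normal_gen n) \<theta> \<eta> \<le> 0"
    and "\<exists>\<theta>. \<exists>\<eta>>0. R (normal_gen n) \<theta> \<eta> < 0"
    using assms dominates_iff[OF normal normal_pos] by auto
  then obtain \<theta>0 \<eta>0 where neg: "\<eta>0 > 0" "R (normal_gen n) \<theta>0 \<eta>0 < 0" by blast
  have mixture_int: "integrable G (\<lambda>z. R (normal_gen n) \<theta> (\<eta> / z))"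
    and mixture_eq: "R f \<theta> \<eta> = (LINT z|G. R (normal_gen n) \<theta> (\<eta> / z))" if "\<eta> > 0" for \<theta> \<eta>
  proof -
    have "integrable lborel (\<lambda>w. location_scale f (\<theta>, 0, c *\<^sub>R \<theta>) \<eta> w * h w)"
      unfolding h_def using f mixture_pos that assms(3,4) fin by (rule integrable_log_ratio_diff)
    note expectation_mixture[OF n[symmetric] that h this]
    then show "integrable G (\<lambda>z. R (normal_gen n) \<theta> (\<eta> / z))"
      and "R f \<theta> \<eta> = (LINT z|G. R (normal_gen n) \<theta> (\<eta> / z))"
      by (simp_all only: R_def)
  qed
  \<comment> \<open>Finiteness of the normal risks at every scale gives the integrability that the
    Laplace transform argument requires.\<close>
  have "isCont (R (normal_gen n) \<theta>0) \<eta>0"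
    unfolding R_def[abs_def] n
  proof (rule isCont_normal_expectation[OF neg(1) h])
    fix \<zeta> :: real assume "\<zeta> > 0"
    with normal normal_pos show "integrable lborel (\<lambda>w. location_scale
        (normal_gen DIM((real^'d) \<times> (real^'k) \<times> (real^'d))) (\<theta>0, 0, c *\<^sub>R \<theta>0) \<zeta> w * h w)"
      unfolding h_def n[symmetric] using assms(3-6) by (rule integrable_log_ratio_diff)
  qed
  \<comment> \<open>Mixing alters the scale but not the location, so strictness for \<open>f\<close>
    is found at the same \<open>\<theta>0\<close>, in general with another
    \<open>\<eta>\<close>.\<close>
  then have "\<exists>\<eta>>0. R f \<theta>0 \<eta> < 0"
    using G.scale_average_neg[of "\<lambda>z. z" "R (normal_gen n) \<theta>0" \<eta>0] G_pos mixture_int R_nonpos neg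
    by (auto simp: mixture_eq)
  moreover have "R f \<theta> \<eta> \<le> 0" if "\<eta> > 0" for \<theta> \<eta>
  proof -
    have "(LINT z|G. R (normal_gen n) \<theta> (\<eta> / z)) \<le> (LINT z|G. 0)"
      using G_pos that
      by (intro integral_mono_AE mixture_int) (auto elim!: eventually_mono intro!: R_nonpos)
    then show ?thesis by (simp add: mixture_eq[OF that])
  qed
  ultimately show "dominates c f q1 q0"
    using dominates_iff[OF f mixture_pos fin] by blast
qed

end
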